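(* Let $n\ge 2$ and let $\mu=(\mu_1\ge\mu_2\ge\dots\ge\mu_{n-1}\ge\mu_n=0)$ be a partition (a dominant weight of type $A_{n-1}$), with conjugate partition $\mu'$. Let $\overline{\mathcal F}(\mu)$, the filling map $f$, the map $\mathrm{ord}$ and the set $B_\mu$ be as defined in the context. Then the composite map $\mathrm{ord}\circ f$ is a bijection from $\overline{\mathcal F}(\mu)$ onto $B_\mu$.
   Context: Permutations $w\in S_n$ are written in one-line notation $w=w(1)\dots w(n)$; $\ell(w)$ is the number of inversions and $<$ denotes Bruhat order. For $1\le i<j\le n$, $(i,j)$ denotes both the positive root $\varepsilon_i-\varepsilon_j$ of type $A_{n-1}$ and the transposition $t_{ij}$; $w(i,j)$ is $w$ with the entries in positions $i$ and $j$ swapped. For $1\le k\le n-1$ let $\Gamma(k)$ be the sequence of roots $((1,n),(1,n-1),\dots,(1,k+1),(2,n),(2,n-1),\dots,(2,k+1),\dots,(k,n),(k,n-1),\dots,(k,k+1))$. Let $\Gamma=\Gamma^{\mu_1}\Gamma^{\mu_1-1}\cdots\Gamma^1=(\beta_1,\dots,\beta_m)$ be the concatenation with $\Gamma^j=\Gamma(\mu'_j)$. A folding pair is $(w,J)$ with $w\in S_n$ and $J=\{j_1<\dots<j_s\}\subseteq\{1,\dots,m\}$; set $w_0=w$, $w_i=w\beta_{j_1}\cdots\beta_{j_i}$ (product of transpositions), $\mathrm{end}(w,J)=w_s$. The element $j_i$ is a negative folding if $w_{i-1}<w_i$ (and positive if $w_{i-1}>w_i$); $J^-$ is the set of negative foldings.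 For $\beta_j=(a,b)$ put $\langle\rho,\beta_j^\vee\rangle=b-a$. Then $\overline{\mathcal F}(\mu)$ is the set of folding pairs with $\frac12(\ell(w)+\ell(\mathrm{end}(w,J))-\#J)+\sum_{j\in J^-}\langle\rho,\beta_j^\vee\rangle=0$. We identify $J$ with the subsequence $T$ of $\Gamma$ at the positions in $J$, factored as $T=T^{\mu_1}\cdots T^1$ with $T^j$ the part lying in $\Gamma^j$. For $j=0,\dots,\mu_1$ let $\pi^j=wT^{\mu_1}T^{\mu_1-1}\cdots T^{j+1}$ (right multiplication by the transpositions, read left to right). The filling map sends $(w,T)$ to the filling $f(w,T)=C^{\mu_1}\cdots C^1$ of the Young diagram of $\mu$, where the column $C^j$ (of height $\mu'_j$) is $C^j=\pi^j(1)\pi^j(2)\cdots\pi^j(\mu'_j)$ read top to bottom, and columns are displayed left to right as $C^{\mu_1},\dots,C^1$ (shortest to longest, top-justified). The map $\mathrm{ord}$ sorts each column increasingly from top to bottom. $B_\mu$ is the set of fillings of the Young diagram of $\mu$ with entries in $\{1,\dots,n\}$ that are strictly increasing down each column (no condition on rows). *)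

theory Defs
  imports Complex_Main "HOL-Combinatorics.Permutations"
begin

(* Elements of S_n are functions w with "w permutes {1..n}"; the word w(1)...w(n) is their
   one-line notation.  A root (a, b) is the pair of its indices a < b. *)

type_synonym root = "nat \<times> nat"

definition perm_length :: "nat \<Rightarrow> (nat \<Rightarrow> nat) \<Rightarrow> nat" where
  "perm_length n w = card {(i, j). 1 \<le> i \<and> i < j \<and> j \<le> n \<and> w j < w i}"

definition bruhat_step :: "nat \<Rightarrow> (nat \<Rightarrow> nat) \<Rightarrow> (nat \<Rightarrow> nat) \<Rightarrow> bool" where
  "bruhat_step n u v \<longleftrightarrow>
     (\<exists>i j. 1 \<le> i \<and> i < j \<and> j \<le> n \<and> v = u \<circ> Transposition.transpose i j \<and>
            perm_length n u < perm_length n v)"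

definition bruhat_less :: "nat \<Rightarrow> (nat \<Rightarrow> nat) \<Rightarrow> (nat \<Rightarrow> nat) \<Rightarrow> bool" where
  "bruhat_less n = (bruhat_step n)\<^sup>+\<^sup>+"

definition right_mult :: "(nat \<Rightarrow> nat) \<Rightarrow> root list \<Rightarrow> (nat \<Rightarrow> nat)" where
  "right_mult w T = foldl (\<lambda>u (a, b). u \<circ> Transposition.transpose a b) w T"

(* A partition is a function \<mu> of which only the values at 1, ..., n matter. *)

definition conj_part :: "nat \<Rightarrow> (nat \<Rightarrow> nat) \<Rightarrow> nat \<Rightarrow> nat" where
  "conj_part n \<mu> j = card {i \<in> {1..n}. j \<le> \<mu> i}"

definition Gamma_k :: "nat \<Rightarrow> nat \<Rightarrow> root list" where
  "Gamma_k n k = concat (map (\<lambda>a. map (\<lambda>b. (a, b)) (rev [k+1..<n+1])) [1..<k+1])"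

definition Gamma_col :: "nat \<Rightarrow> (nat \<Rightarrow> nat) \<Rightarrow> nat \<Rightarrow> root list" where
  "Gamma_col n \<mu> j = Gamma_k n (conj_part n \<mu> j)"

(* The initial segment made of the blocks with indices \<mu> 1, \<mu> 1 - 1, ..., j + 1. *)
definition Gamma_above :: "nat \<Rightarrow> (nat \<Rightarrow> nat) \<Rightarrow> nat \<Rightarrow> root list" where
  "Gamma_above n \<mu> j = concat (map (Gamma_col n \<mu>) (rev [j+1..<\<mu> 1 + 1]))"

definition Gamma_chain :: "nat \<Rightarrow> (nat \<Rightarrow> nat) \<Rightarrow> root list" where
  "Gamma_chain n \<mu> = Gamma_above n \<mu> 0"

(* Positions in the chain are counted from 1. *)
definition chain_root :: "nat \<Rightarrow> (nat \<Rightarrow> nat) \<Rightarrow> nat \<Rightarrow> root" where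
  "chain_root n \<mu> p = Gamma_chain n \<mu> ! (p - 1)"

definition folding_pairs :: "nat \<Rightarrow> (nat \<Rightarrow> nat) \<Rightarrow> ((nat \<Rightarrow> nat) \<times> nat set) set" where
  "folding_pairs n \<mu> = {(w, J). w permutes {1..n} \<and> J \<subseteq> {1..length (Gamma_chain n \<mu>)}}"

definition partial_fold ::
    "nat \<Rightarrow> (nat \<Rightarrow> nat) \<Rightarrow> (nat \<Rightarrow> nat) \<Rightarrow> nat set \<Rightarrow> nat \<Rightarrow> (nat \<Rightarrow> nat)" where
  "partial_fold n \<mu> w J i = right_mult w (map (chain_root n \<mu>) (take i (sorted_list_of_set J)))"

definition end_fold ::
    "nat \<Rightarrow> (nat \<Rightarrow> nat) \<Rightarrow> (nat \<Rightarrow> nat) \<Rightarrow> nat set \<Rightarrow> (nat \<Rightarrow> nat)" where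
  "end_fold n \<mu> w J = partial_fold n \<mu> w J (card J)"

definition negative_foldings ::
    "nat \<Rightarrow> (nat \<Rightarrow> nat) \<Rightarrow> (nat \<Rightarrow> nat) \<Rightarrow> nat set \<Rightarrow> nat set" where
  "negative_foldings n \<mu> w J =
     {sorted_list_of_set J ! (i - 1) | i. i \<in> {1..card J} \<and>
        bruhat_less n (partial_fold n \<mu> w J (i - 1)) (partial_fold n \<mu> w J i)}"

definition rho_pairing :: "root \<Rightarrow> rat" where
  "rho_pairing \<beta> = of_nat (snd \<beta>) - of_nat (fst \<beta>)"

definition F_bar :: "nat \<Rightarrow> (nat \<Rightarrow> nat) \<Rightarrow> ((nat \<Rightarrow> nat) \<times> nat set) set" where
  "F_bar n \<mu> = {(w, J) \<in> folding_pairs n \<mu>.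
     1/2 * (of_nat (perm_length n w) + of_nat (perm_length n (end_fold n \<mu> w J)) - of_nat (card J))
       + (\<Sum>p \<in> negative_foldings n \<mu> w J. rho_pairing (chain_root n \<mu> p)) = 0}"

definition block_positions :: "nat \<Rightarrow> (nat \<Rightarrow> nat) \<Rightarrow> nat \<Rightarrow> nat set" where
  "block_positions n \<mu> j =
     {length (Gamma_above n \<mu> j) <.. length (Gamma_above n \<mu> j) + length (Gamma_col n \<mu> j)}"

definition T_part :: "nat \<Rightarrow> (nat \<Rightarrow> nat) \<Rightarrow> nat set \<Rightarrow> nat \<Rightarrow> root list" where
  "T_part n \<mu> J j = map (chain_root n \<mu>) (sorted_list_of_set (J \<inter> block_positions n \<mu> j))"

definition pi_perm ::
    "nat \<Rightarrow> (nat \<Rightarrow> nat) \<Rightarrow> (nat \<Rightarrow> nat) \<Rightarrow> nat set \<Rightarrow> nat \<Rightarrow> (nat \<Rightarrow> nat)" where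
  "pi_perm n \<mu> w J j = right_mult w (concat (map (T_part n \<mu> J) (rev [j+1..<\<mu> 1 + 1])))"

(* A filling is the list of its columns from left to right, i.e. with column indices
   \<mu> 1, ..., 1; each column is the list of its entries from top to bottom. *)

definition filling_map :: "nat \<Rightarrow> (nat \<Rightarrow> nat) \<Rightarrow> (nat \<Rightarrow> nat) \<times> nat set \<Rightarrow> nat list list" where
  "filling_map n \<mu> = (\<lambda>(w, J).
     map (\<lambda>j. map (pi_perm n \<mu> w J j) [1..<conj_part n \<mu> j + 1]) (rev [1..<\<mu> 1 + 1]))"

definition ord_cols :: "nat list list \<Rightarrow> nat list list" where
  "ord_cols = map sort"

definition B_fillings :: "nat \<Rightarrow> (nat \<Rightarrow> nat) \<Rightarrow> nat list list set" where
  "B_fillings n \<mu> = {F. map length F = map (conj_part n \<mu>) (rev [1..<\<mu> 1 + 1]) \<and>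
     (\<forall>C \<in> set F. set C \<subseteq> {1..n} \<and> sorted_wrt (<) C)}"

end

theory Submission
  imports Defs
begin

text \<open>
  Let $d_i$ be the change of length at the $i$-th folding, along the root $\beta$. Then
  $|d_i| \le 2\langle\rho,\beta^\vee\rangle - 1$, and twice the quantity which has to vanish on
  $\overline{\mathcal F}(\mu)$ equals twice the length of the end point plus
  $-d_i - 1$ for every positive and $2\langle\rho,\beta^\vee\rangle - d_i - 1$ for every negative
  folding. All these terms are nonnegative, so the end point is the identity and, read backwards,
  the foldings form a path in the quantum Bruhat graph. In type A an edge $(a,b)$ from $w$ is
  characterised by the cyclic order on the values: no $w(c)$ with $a < c < b$ lies on the cyclic arc
  from $w(a)$ to $w(b)$.

  It remains to see that, for a given permutation $v$ and a $k$-subset $S$, there is exactly one such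
  path ending at $v$ along $\Gamma(k)$ whose first $k$ entries form the set $S$. Within the row $a$
  of $\Gamma(k)$ the entry $v(a)$ moves forward on the circle to an entry $y_a$ without jumping over
  $y_{a+1},\dots,y_k$, and its itinerary is determined by $y_a$. Hence $y_a$ is forced to be the first
  element of $S \setminus \{y_1,\dots,y_{a-1}\}$ on the circle starting from $v(a)$.
\<close>

section \<open>Quantum Bruhat steps and the cyclic order\<close>

text \<open>$z$ lies strictly inside the cyclic arc from $x$ up to $y$.\<close>

definition cyc :: "nat \<Rightarrow> nat \<Rightarrow> nat \<Rightarrow> bool" where
  "cyc x z y \<longleftrightarrow> x < z \<and> z < y \<or> z < y \<and> y < x \<or> y < x \<and> x < z"

text \<open>
  The folding from $w$ to $w(a,b)$ is traversed against the edge of the quantum Bruhat graph, so the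
  arc starts at $w(b)$.
\<close>

definition good_step :: "(nat \<Rightarrow> nat) \<Rightarrow> nat \<Rightarrow> nat \<Rightarrow> bool" where
  "good_step w a b \<longleftrightarrow> (\<forall>c\<in>{a<..<b}. \<not> cyc (w b) (w c) (w a))"

text \<open>The Boolean list marks the roots of the chain which are folded.\<close>

fun folds :: "(nat \<Rightarrow> nat) \<Rightarrow> bool list \<Rightarrow> root list \<Rightarrow> (nat \<Rightarrow> nat) \<Rightarrow> bool" where
  "folds w [] [] v \<longleftrightarrow> w = v"
| "folds w (b # bs) (r # G) v \<longleftrightarrow>
     (if b then good_step w (fst r) (snd r) \<and> folds (w \<circ> Transposition.transpose (fst r) (snd r)) bs G v
      else folds w bs G v)"
| "folds w _ _ v \<longleftrightarrow> False"

abbreviation selected :: "bool list \<Rightarrow> root list \<Rightarrow> root list" where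
  "selected bs G \<equiv> map snd (filter fst (zip bs G))"

lemma right_mult_Nil [simp]: "right_mult w [] = w"
  by (simp add: right_mult_def)

lemma right_mult_Cons [simp]:
  "right_mult w (r # T) = right_mult (w \<circ> Transposition.transpose (fst r) (snd r)) T"
  by (simp add: right_mult_def case_prod_unfold)

lemma eq_by_take_drop: "take l xs = take l ys \<Longrightarrow> drop l xs = drop l ys \<Longrightarrow> xs = ys"
  by (metis append_take_drop_id)

lemma folds_length: "folds w bs G v \<Longrightarrow> length bs = length G"
  by (induction w bs G v rule: folds.induct) (auto split: if_splits)

lemma folds_append:
  "folds w bs (G @ H) v \<longleftrightarrow>
     (\<exists>u. folds w (take (length G) bs) G u \<and> folds u (drop (length G) bs) H v)"
proof (induction G arbitrary: w bs)
  case Nil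
  then show ?case by simp
next
  case (Cons r G)
  then show ?case by (cases bs) (auto simp del: o_apply)
qed

text \<open>The factor stands on the right because foldings swap positions;
  \<open>folds_image\<close> reads off from it which entries stay and which sets of values are
  preserved.\<close>

lemma folds_permutes:
  assumes "folds w bs G v" and "\<And>r. r \<in> set G \<Longrightarrow> fst r \<in> A \<and> snd r \<in> A"
  shows "\<exists>p. p permutes A \<and> w = v \<circ> p"
  using assms
proof (induction w bs G v rule: folds.induct)
  case (1 w v)
  then show ?case by (auto intro!: exI[of _ id] permutes_id)
next
  case (2 w b bs r G v)
  let ?t = "Transposition.transpose (fst r) (snd r)"
  show ?case
  proof (cases b)
    case True
    then obtain p where p: "p permutes A" "w \<circ> ?t = v \<circ> p" using 2 by (auto simp del: o_apply)
    have "w = w \<circ> ?t \<circ> ?t" by (simp add: comp_assoc)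
    also have "\<dots> = v \<circ> (p \<circ> ?t)" using p by (simp add: comp_assoc)
    finally show ?thesis using p 2(4)[of r]
      by (auto intro!: exI[of _ "p \<circ> ?t"] permutes_compose permutes_swap_id)
  next
    case False
    then show ?thesis using 2 by auto
  qed
qed auto

lemma folds_image:
  assumes "folds w bs G v" and "\<And>r. r \<in> set G \<Longrightarrow> fst r \<in> A \<and> snd r \<in> A"
  shows "w ` A = v ` A" and "c \<notin> A \<Longrightarrow> w c = v c"
    and "A \<subseteq> B \<Longrightarrow> v permutes B \<Longrightarrow> w permutes B"
proof -
  obtain p where p: "p permutes A" "w = v \<circ> p" using folds_permutes[OF assms] by blast
  show "w ` A = v ` A" using permutes_image[OF p(1)] by (metis p(2) image_comp)
  show "c \<notin> A \<Longrightarrow> w c = v c" using permutes_not_in[OF p(1)] p(2) by auto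
  show "A \<subseteq> B \<Longrightarrow> v permutes B \<Longrightarrow> w permutes B"
    using p permutes_subset permutes_compose by blast
qed

section \<open>Extremal elements on arcs of the circle of values\<close>

lemma cyc_predecessor:
  assumes "finite A" "A \<noteq> {}" "y \<notin> A"
  obtains x where "x \<in> A" "\<And>z. z \<in> A \<Longrightarrow> \<not> cyc x z y"
proof (cases "{z \<in> A. z < y} = {}")
  case True
  show ?thesis
  proof (rule that[of "Max A"])
    fix z assume "z \<in> A"
    then show "\<not> cyc (Max A) z y" using assms True Max_ge[of A z] Max_in[of A]
      by (force simp: cyc_def)
  qed (use assms in auto)
next
  case False
  let ?M = "{z \<in> A. z < y}"
  have f: "finite ?M" using assms by auto
  have m: "Max ?M \<in> ?M" using Max_in[OF f False] .
  show ?thesis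
  proof (rule that[of "Max ?M"])
    fix z assume "z \<in> A"
    then show "\<not> cyc (Max ?M) z y" using m Max_ge[OF f, of z]
      by (fastforce simp: cyc_def)
  qed (use m in auto)
qed

text \<open>The first element of \<open>A\<close> met from \<open>x\<close> onwards, with
  \<open>x\<close> itself allowed. The clause \<open>x \<notin> A - {y}\<close> forces
  \<open>y = x\<close> whenever \<open>x\<close> lies in \<open>A\<close>; the open arcs of
  \<open>cyc\<close> alone do not see this case.\<close>

lemma cyc_successor:
  assumes "finite A" "A \<noteq> {}"
  obtains y where "y \<in> A" "x \<notin> A - {y}" "\<And>z. z \<in> A - {y} \<Longrightarrow> \<not> cyc x z y"
proof (cases "{z \<in> A. x \<le> z} = {}")
  case True
  show ?thesis
  proof (rule that[of "Min A"])
    fix z assume "z \<in> A - {Min A}"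
    then show "\<not> cyc x z (Min A)" using assms True Min_le[of A z] Min_in[of A]
      by (force simp: cyc_def)
  qed (use assms True in auto)
next
  case False
  let ?M = "{z \<in> A. x \<le> z}"
  have f: "finite ?M" using assms by auto
  have m: "Min ?M \<in> ?M" using Min_in[OF f False] .
  show ?thesis
  proof (rule that[of "Min ?M"])
    fix z assume "z \<in> A - {Min ?M}"
    then show "\<not> cyc x z (Min ?M)" using m Min_le[OF f, of z]
      by (fastforce simp: cyc_def)
  next
    show "x \<notin> A - {Min ?M}" using m Min_le[OF f, of x] by auto
  qed (use m in auto)
qed

lemma cyc_trichotomy:
  "x \<noteq> y \<Longrightarrow> x \<noteq> z \<Longrightarrow> y \<noteq> z \<Longrightarrow> \<not> cyc x z y \<Longrightarrow> cyc z x y"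
  by (auto simp: cyc_def)

lemma cyc_total: "x \<noteq> y \<Longrightarrow> x \<noteq> z \<Longrightarrow> y \<noteq> z \<Longrightarrow> cyc x z y \<or> cyc x y z"
  by (auto simp: cyc_def)

lemma cyc_extend: "cyc v x y \<Longrightarrow> cyc v c x \<Longrightarrow> cyc v c y"
  by (auto simp: cyc_def)

lemma cyc_extend': "cyc v x y \<Longrightarrow> cyc x c y \<Longrightarrow> cyc v c y"
  by (auto simp: cyc_def)

lemma cyc_split: "cyc v x y \<Longrightarrow> cyc v c y \<Longrightarrow> c = x \<or> cyc v c x \<or> cyc x c y"
  by (auto simp: cyc_def)

lemma cyc_irrefl [simp]: "\<not> cyc x x y" "\<not> cyc x y y" "\<not> cyc x y x"
  by (auto simp: cyc_def)

section \<open>Paths along one row of $\Gamma(k)$\<close>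

text \<open>The cutoff \<open>m\<close> serves inductions in which \<open>row_Suc\<close> strips the
  first root \<open>(a, Suc m)\<close> while the end point \<open>v\<close> of the path stays fixed.
  The full row of the chain is the case \<open>m = n\<close>.\<close>

definition row :: "nat \<Rightarrow> nat \<Rightarrow> nat \<Rightarrow> root list" where
  "row a k m = map (Pair a) (rev [k+1..<m+1])"

lemma row_self [simp]: "row a k k = []"
  by (simp add: row_def)

lemma row_Suc: "k \<le> m \<Longrightarrow> row a k (Suc m) = (a, Suc m) # row a k m"
  by (simp add: row_def)

lemma row_support: "r \<in> set (row a k m) \<Longrightarrow> fst r \<in> insert a {k<..m} \<and> snd r \<in> insert a {k<..m}"
  by (auto simp: row_def)

lemma row_image:
  assumes "folds w bs (row a k m) v"
  shows "w ` insert a {k<..m} = v ` insert a {k<..m}" and "c \<notin> insert a {k<..m} \<Longrightarrow> w c = v c"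
    and "insert a {k<..m} \<subseteq> B \<Longrightarrow> v permutes B \<Longrightarrow> w permutes B"
  using folds_image[OF assms, of "insert a {k<..m}"] row_support by blast+

text \<open>If \<open>(a, Suc m)\<close> is folded, leading to \<open>u\<close>, the arc from
  \<open>v a\<close> to \<open>w a\<close> consists of a possibly degenerate arc to
  \<open>u a\<close> and the arc from \<open>u a\<close> to \<open>w a\<close>. The induction
  hypothesis keeps \<open>v c\<close> off the first piece, the good step off the second.\<close>

lemma row_no_skip:
  assumes "a \<le> k" "k \<le> m" "inj v" "folds w bs (row a k m) v" "c \<in> {a<..k}"
  shows "\<not> cyc (v a) (v c) (w a)"
  using assms(2,4)
proof (induction m arbitrary: w bs rule: dec_induct)
  case base
  then show ?case by (cases bs) auto
next
  case (step m)
  then obtain b bs' where bs: "bs = b # bs'" by (cases bs) (auto simp: row_Suc)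
  show ?case
  proof (cases b)
    case False
    then show ?thesis using step bs by (auto simp: row_Suc)
  next
    case True
    define u where "u = w \<circ> Transposition.transpose a (Suc m)"
    have u: "good_step w a (Suc m)" "folds u bs' (row a k m) v"
      using True step bs by (auto simp: row_Suc u_def)
    have ua: "u a = w (Suc m)" "u (Suc m) = w a"
      and uc: "\<And>c. c \<noteq> a \<Longrightarrow> c \<noteq> Suc m \<Longrightarrow> u c = w c"
      using step assms(1) by (auto simp: u_def transpose_def)
    have IH: "\<not> cyc (v a) (v c) (u a)" using step.IH u by blast
    have veq: "v x = v z \<longleftrightarrow> x = z" for x z using inj_eq[OF \<open>inj v\<close>] .
    have am: "a < Suc m" "a \<le> m" using assms(1) step.hyps by auto
    have out: "\<And>c. c \<notin> insert a {k<..m} \<Longrightarrow> u c = v c" using row_image(2)[OF u(2)] by blast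
    have wc: "w c = v c" using out[of c] uc[of c] assms(5) step by auto
    have wa: "w a = v (Suc m)" using out[of "Suc m"] ua am by auto
    obtain d where d: "d \<in> insert a {k<..m}" "v a = u d" using row_image(1)[OF u(2)] by blast
    \<comment> \<open>In \<open>u\<close> the value \<open>v a\<close> sits at \<open>a\<close> or
      at a position between \<open>a\<close> and \<open>Suc m\<close>; in the latter case the good
      step keeps it off the arc from \<open>u a\<close> to \<open>w a\<close>.\<close>
    have va: "v a = u a \<or> \<not> cyc (u a) (v a) (w a)"
    proof (cases "d = a")
      case False
      then have "d \<in> {a<..<Suc m}" "u d = w d" using d(1) uc[of d] assms(1) by auto
      then show ?thesis using u(1) ua(1) d(2) by (simp add: good_step_def)
    qed (use d in simp)
    have "v a \<noteq> w a" using wa am by (simp add: veq)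
    moreover have "u a \<noteq> w a"
    proof
      assume "u a = w a"
      then have "v (Suc m) \<in> v ` insert a {k<..m}" using wa row_image(1)[OF u(2)] by auto
      then show False using am by (auto simp: veq)
    qed
    ultimately have "v a = u a \<or> cyc (v a) (u a) (w a)"
      using va by (metis cyc_trichotomy)
    moreover have "\<not> cyc (u a) (v c) (w a)"
    proof -
      have "c \<in> {a<..<Suc m}" using assms(5) step.hyps by auto
      then have "\<not> cyc (w (Suc m)) (w c) (w a)" using u(1) by (simp only: good_step_def) blast
      then show ?thesis using wc ua(1) by simp
    qed
    moreover have "v c \<noteq> u a"
    proof
      assume "v c = u a"
      then have "v c \<in> v ` insert a {k<..m}" using row_image(1)[OF u(2)] by auto
      then show False using assms(5) by (auto simp: veq)
    qed
    ultimately show ?thesis using IH cyc_split by metis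
  qed
qed

text \<open>The entry \<open>w a\<close> determines the itinerary: \<open>(a, Suc m)\<close> is
  folded exactly when \<open>w a = v (Suc m)\<close>, and then the next entry at \<open>a\<close> is
  the cyclic predecessor of \<open>w a\<close> among the values of \<open>v\<close> on
  \<open>insert a {k<..m}\<close>.\<close>

lemma row_unique:
  assumes "a \<le> k" "k \<le> m" "inj v"
    and "folds w bs (row a k m) v" "folds w' bs' (row a k m) v" "w a = w' a"
  shows "w = w' \<and> bs = bs'"
  using assms(2,4-)
proof (induction m arbitrary: w bs w' bs' rule: dec_induct)
  case base
  then show ?case by (cases bs; cases bs') auto
next
  case (step m)
  have veq: "v x = v z \<longleftrightarrow> x = z" for x z using inj_eq[OF \<open>inj v\<close>] .
  have am: "a < Suc m" "a \<le> m" using assms(1) step.hyps by auto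
  have *: "(b \<longleftrightarrow> w a = v (Suc m)) \<and>
      (b \<longrightarrow> folds (w \<circ> Transposition.transpose a (Suc m)) bs (row a k m) v \<and>
        w (Suc m) \<in> v ` insert a {k<..m} \<and>
        (\<forall>z\<in>v ` insert a {k<..m}. \<not> cyc (w (Suc m)) z (w a)))"
    if "folds w (b # bs) (row a k (Suc m)) v" for w b bs
  proof (cases b)
    case False
    then have f: "folds w bs (row a k m) v" using that step by (auto simp: row_Suc)
    have "w a \<in> v ` insert a {k<..m}" using row_image(1)[OF f] by auto
    then have "w a \<noteq> v (Suc m)" using am by (auto simp: veq)
    then show ?thesis using False by simp
  next
    case True
    define u where "u = w \<circ> Transposition.transpose a (Suc m)"
    have u: "good_step w a (Suc m)" "folds u bs (row a k m) v"
      using True that step by (auto simp: row_Suc u_def)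
    have ua: "u a = w (Suc m)" "u (Suc m) = w a"
      and uc: "\<And>c. c \<noteq> a \<Longrightarrow> c \<noteq> Suc m \<Longrightarrow> u c = w c"
      using step assms(1) by (auto simp: u_def transpose_def)
    have wa: "w a = v (Suc m)"
      using row_image(2)[OF u(2), of "Suc m"] ua step assms(1) by auto
    have img: "v ` insert a {k<..m} = u ` insert a {k<..m}" using row_image(1)[OF u(2)] by simp
    have "\<not> cyc (w (Suc m)) (u c) (w a)" if "c \<in> insert a {k<..m}" for c
      using that u(1) ua uc[of c] assms(1) step unfolding good_step_def by (cases "c = a") auto
    then show ?thesis using True wa u(2) ua img unfolding u_def by auto
  qed
  obtain b bs1 where bs: "bs = b # bs1" using step.prems by (cases bs) (auto simp: row_Suc step)
  obtain b' bs1' where bs': "bs' = b' # bs1'" using step.prems by (cases bs') (auto simp: row_Suc step)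
  note w = *[OF step.prems(1)[unfolded bs]] and w' = *[OF step.prems(2)[unfolded bs']]
  show ?case
  proof (cases b)
    case False
    then show ?thesis using w w' step bs bs' by (auto simp: row_Suc)
  next
    case True
    then have b': b' using w w' step by auto
    let ?t = "Transposition.transpose a (Suc m)"
    let ?A = "v ` insert a {k<..m}"
    have notin: "w a \<notin> ?A" using w True am by (auto simp: veq)
    have mem: "w (Suc m) \<in> ?A" "w' (Suc m) \<in> ?A"
      and "\<not> cyc (w (Suc m)) (w' (Suc m)) (w a)" "\<not> cyc (w' (Suc m)) (w (Suc m)) (w a)"
      using w w' True b' step.prems(3) by metis+
    \<comment> \<open>Of two distinct elements of \<open>?A\<close>, one lies on the arc from the
      other to \<open>w a\<close>, so they cannot both be predecessors.\<close>
    then have "w (Suc m) = w' (Suc m)"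
      using cyc_trichotomy[of "w (Suc m)" "w a" "w' (Suc m)"] notin by metis
    then have "(w \<circ> ?t) a = (w' \<circ> ?t) a" by simp
    then have "w \<circ> ?t = w' \<circ> ?t \<and> bs1 = bs1'"
      using step.IH w w' True b' by blast
    moreover from this have "w \<circ> ?t \<circ> ?t = w' \<circ> ?t \<circ> ?t" by simp
    then have "w = w'" by (simp add: comp_assoc)
    ultimately show ?thesis using True b' bs bs' by simp
  qed
qed

text \<open>The itinerary of \<open>row_unique\<close> is realised: for \<open>y = v (Suc m)\<close>
  the induction hypothesis gives a path whose entry at \<open>a\<close> is the cyclic predecessor
  \<open>x\<close> of \<open>y\<close>, and one folding is put in front of it.\<close>

lemma row_exists:
  assumes "a \<le> k" "k \<le> m" "inj v"
    and "y \<in> v ` insert a {k<..m}" "\<And>c. c \<in> {a<..k} \<Longrightarrow> \<not> cyc (v a) (v c) y"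
  shows "\<exists>w bs. folds w bs (row a k m) v \<and> w a = y"
  using assms(2,4-)
proof (induction m arbitrary: y rule: dec_induct)
  case base
  then show ?case by (auto intro!: exI[of _ v] exI[of _ "[]"])
next
  case (step m)
  show ?case
  proof (cases "y = v (Suc m)")
    case False
    then have "y \<in> v ` insert a {k<..m}" using step.prems(1) by (auto simp: less_Suc_eq_le le_Suc_eq)
    then obtain w bs where "folds w bs (row a k m) v" "w a = y" using step by blast
    then show ?thesis using step by (auto simp: row_Suc intro!: exI[of _ w] exI[of _ "False # bs"])
  next
    case True
    let ?A = "v ` insert a {k<..m}"
    have y: "y \<notin> ?A" using True assms(1) step.hyps by (auto simp: inj_eq[OF \<open>inj v\<close>])
    obtain x where x: "x \<in> ?A" "\<And>z. z \<in> ?A \<Longrightarrow> \<not> cyc x z y"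
      using cyc_predecessor[of ?A y] y by auto
    \<comment> \<open>As an element of \<open>?A\<close>, \<open>v a\<close> is not strictly between
      \<open>x\<close> and \<open>y\<close>; hence \<open>x\<close> is on the way from
      \<open>v a\<close> to \<open>y\<close>.\<close>
    have vx: "v a = x \<or> cyc (v a) x y"
      using x y by (metis cyc_trichotomy image_insert insertI1)
    have "\<exists>u bs. folds u bs (row a k m) v \<and> u a = x"
      using step.IH[OF x(1)] vx step.prems(2) by (metis cyc_extend cyc_irrefl(1,3))
    then obtain u bs where u: "folds u bs (row a k m) v" "u a = x" by blast
    define w where "w = u \<circ> Transposition.transpose a (Suc m)"
    have am: "a < Suc m" using assms(1) step by simp
    have w: "w a = u (Suc m)" "w (Suc m) = x" "\<And>c. c \<noteq> a \<Longrightarrow> c \<noteq> Suc m \<Longrightarrow> w c = u c"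
      using u(2) by (auto simp: w_def transpose_def)
    have wa: "w a = y" using w(1) True row_image(2)[OF u(1), of "Suc m"] am by auto
    \<comment> \<open>Positions up to \<open>k\<close> carry entries of \<open>v\<close>, excluded
      by hypothesis from the longer arc starting at \<open>v a\<close>; positions beyond
      \<open>k\<close> carry values in \<open>?A\<close>, excluded by the choice of
      \<open>x\<close>.\<close>
    have "\<not> cyc x (w c) y" if c: "c \<in> {a<..<Suc m}" for c
    proof (cases "c \<le> k")
      case True
      then have "w c = v c" using c w(3)[of c] row_image(2)[OF u(1), of c] by auto
      then show ?thesis using step.prems(2)[of c] vx c True cyc_extend' by auto
    next
      case False
      then have "w c \<in> ?A" using c w(3)[of c] row_image(1)[OF u(1)] by auto
      then show ?thesis using x by blast
    qed
    then have "good_step w a (Suc m)" using w(2) wa by (simp add: good_step_def)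
    moreover have "w \<circ> Transposition.transpose a (Suc m) = u" by (simp add: w_def comp_assoc)
    ultimately have "folds w (True # bs) (row a k (Suc m)) v" using u step by (simp add: row_Suc)
    then show ?thesis using wa by blast
  qed
qed

section \<open>Paths along $\Gamma(k)$ and along the whole chain\<close>

text \<open>The start \<open>a\<close> is a parameter so that induction can run from the empty chain
  at \<open>a = Suc k\<close> down to \<open>a = 1\<close>, which is Gamma(k).\<close>

definition rows :: "nat \<Rightarrow> nat \<Rightarrow> nat \<Rightarrow> root list" where
  "rows n k a = concat (map (\<lambda>a. row a k n) [a..<Suc k])"

lemma Gamma_k_rows: "Gamma_k n k = rows n k 1"
  by (simp add: Gamma_k_def rows_def row_def)

lemma rows_end [simp]: "rows n k (Suc k) = []"
  by (simp add: rows_def)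

lemma rows_step: "a \<le> k \<Longrightarrow> rows n k a = row a k n @ rows n k (Suc a)"
  by (simp add: rows_def upt_conv_Cons del: upt_Suc)

lemma rows_support: "r \<in> set (rows n k a) \<Longrightarrow> fst r \<in> {a..k} \<union> {k<..n} \<and> snd r \<in> {a..k} \<union> {k<..n}"
  by (auto simp: rows_def row_def simp del: upt_Suc)

lemma rows_image:
  assumes "folds w bs (rows n k a) v"
  shows "c \<notin> {a..k} \<union> {k<..n} \<Longrightarrow> w c = v c"
    and "v permutes {1..n} \<Longrightarrow> 1 \<le> a \<Longrightarrow> k \<le> n \<Longrightarrow> w permutes {1..n}"
proof -
  note f = folds_image[OF assms, of "{a..k} \<union> {k<..n}"]
  show "c \<notin> {a..k} \<union> {k<..n} \<Longrightarrow> w c = v c" using f(2) rows_support by blast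
  assume *: "v permutes {1..n}" "1 \<le> a" "k \<le> n"
  then have "{a..k} \<union> {k<..n} \<subseteq> {1..n}" by auto
  then show "w permutes {1..n}" using f(3) rows_support * by blast
qed

text \<open>Row \<open>a\<close> changes only position \<open>a\<close> and those beyond
  \<open>k\<close>, and later rows never touch \<open>a\<close>. So \<open>u a = v a\<close>, the
  rest of \<open>S\<close> is already in place in \<open>u\<close>, and \<open>row_no_skip\<close>
  makes \<open>w a\<close> the first element of \<open>S\<close> on the circle from
  \<open>v a\<close>.\<close>

lemma rows_first_entry:
  assumes "1 \<le> a" "a \<le> k" "k \<le> n" "v permutes {1..n}"
    and "folds w bs1 (row a k n) u" "folds u bs2 (rows n k (Suc a)) v" "w ` {a..k} = S"
  shows "w a \<in> S" "v a \<notin> S - {w a}" "\<And>z. z \<in> S - {w a} \<Longrightarrow> \<not> cyc (v a) z (w a)"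
    "u ` {Suc a..k} = S - {w a}"
proof -
  have u: "u permutes {1..n}"
    using rows_image(2)[OF assms(6,4)] assms(1-3) by auto
  have w: "w permutes {1..n}"
    using assms(1-3) by (intro row_image(3)[OF assms(5) _ u]) auto
  note inju = permutes_inj[OF u] and injw = permutes_inj[OF w]
  have ua: "u a = v a" using rows_image(1)[OF assms(6), of a] assms(2) by auto
  have wc: "w c = u c" if "c \<in> {a<..k}" for c
    using row_image(2)[OF assms(5), of c] that by auto
  have ins: "{a..k} = insert a {a<..k}" using assms(2) by auto
  show "w a \<in> S" using assms(2,7) by auto
  have "S - {w a} = w ` {a<..k}" 
    unfolding assms(7)[symmetric] ins by (auto simp: inj_eq[OF injw])
  also have "\<dots> = u ` {a<..k}" using wc by auto
  finally have S: "S - {w a} = u ` {a<..k}" .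
  then show "u ` {Suc a..k} = S - {w a}" by (simp add: atLeastSucAtMost_greaterThanAtMost)
  show "v a \<notin> S - {w a}" unfolding S ua[symmetric] by (auto simp: inj_eq[OF inju])
  show "\<not> cyc (v a) z (w a)" if "z \<in> S - {w a}" for z
    using that row_no_skip[OF assms(2,3) inju assms(5)] unfolding S ua[symmetric] by blast
qed

lemma rows_unique:
  assumes "k \<le> n" "v permutes {1..n}" "1 \<le> a" "a \<le> Suc k"
    and "folds w bs (rows n k a) v" "folds w' bs' (rows n k a) v" "w ` {a..k} = w' ` {a..k}"
  shows "w = w' \<and> bs = bs'"
  using assms(4,3,5-)
proof (induction a arbitrary: w w' bs bs' rule: inc_induct)
  case base
  then show ?case by (cases bs; cases bs') auto
next
  case (step a)
  have ak: "a \<le> k" using step by simp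
  define S where "S = w ` {a..k}"
  let ?l = "length (row a k n)"
  obtain u where u: "folds w (take ?l bs) (row a k n) u" "folds u (drop ?l bs) (rows n k (Suc a)) v"
    using step.prems(2) rows_step[OF ak] by (auto simp: folds_append)
  obtain u' where u': "folds w' (take ?l bs') (row a k n) u'" "folds u' (drop ?l bs') (rows n k (Suc a)) v"
    using step.prems(3) rows_step[OF ak] by (auto simp: folds_append)
  note f = rows_first_entry[OF step.prems(1) ak assms(1,2) u S_def[symmetric]]
  note f' = rows_first_entry[OF step.prems(1) ak assms(1,2) u' step.prems(4)[symmetric, folded S_def]]
  \<comment> \<open>Two distinct first elements of \<open>S\<close> would both differ from
    \<open>v a\<close>, and one of them would lie on the arc from \<open>v a\<close> to the
    other.\<close>
  have wa: "w a = w' a" using f(1-3) f'(1-3) by (metis cyc_total Diff_iff singletonD)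
  then have "u ` {Suc a..k} = u' ` {Suc a..k}" using f(4) f'(4) by simp
  then have uu: "u = u' \<and> drop ?l bs = drop ?l bs'" using step.IH u(2) u'(2) by auto
  have "inj u" using rows_image(2)[OF u(2) assms(2)] assms(1) by (auto intro: permutes_inj)
  then have "w = w' \<and> take ?l bs = take ?l bs'"
    using row_unique[OF ak assms(1) _ u(1)] u'(1) uu wa by auto
  then show ?case using uu eq_by_take_drop[of ?l bs bs'] by blast
qed

text \<open>Rows from \<open>a\<close> on cannot move the first \<open>a - 1\<close> entries of
  \<open>v\<close>, so \<open>S\<close> has to avoid them. This is vacuous at \<open>a = 1\<close>
  and is passed on because \<open>S - {y}\<close> avoids \<open>v a\<close>.\<close>

lemma rows_exists:
  assumes "k \<le> n" "v permutes {1..n}" "1 \<le> a" "a \<le> Suc k"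
    and "S \<subseteq> {1..n}" "card S = Suc k - a" "S \<inter> v ` {1..<a} = {}"
  shows "\<exists>w bs. folds w bs (rows n k a) v \<and> w ` {a..k} = S"
  using assms(4,3,5-)
proof (induction a arbitrary: S rule: inc_induct)
  case base
  then have "S = {}" using finite_subset[of S "{1..n}"] by auto
  then show ?case by (auto intro!: exI[of _ v] exI[of _ "[]"])
next
  case (step a)
  have ak: "a \<le> k" using step by simp
  have fin: "finite S" "S \<noteq> {}" using step finite_subset[of S "{1..n}"] by auto
  obtain y where y: "y \<in> S" "v a \<notin> S - {y}" "\<And>z. z \<in> S - {y} \<Longrightarrow> \<not> cyc (v a) z y"
    using cyc_successor[OF fin, of "v a"] by blast
  have "{1..<Suc a} = insert a {1..<a}" using step by auto
  then have "(S - {y}) \<inter> v ` {1..<Suc a} = {}" using step.prems(4) y(2) by auto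
  then obtain u bs2 where u: "folds u bs2 (rows n k (Suc a)) v" "u ` {Suc a..k} = S - {y}"
    using step.IH[of "S - {y}"] step.prems fin y(1) by (auto simp: card_Diff_singleton subset_iff)
  have up: "u permutes {1..n}" using rows_image(2)[OF u(1) assms(2)] assms(1) by auto
  have uc: "u c = v c" if "c \<le> a" for c using rows_image(1)[OF u(1), of c] that ak by auto
  have "y \<in> u ` {1..n}" using y(1) step.prems(2) permutes_image[OF up] by auto
  then obtain c where c: "c \<in> {1..n}" "y = u c" by auto
  \<comment> \<open>A position before \<open>a\<close> would violate the disjointness, and the
    positions after \<open>a\<close> up to \<open>k\<close> carry \<open>S - {y}\<close>; so
    \<open>y\<close> is within reach of row \<open>a\<close>.\<close>
  have "\<not> c < a" using c uc[of c] y(1) step.prems(4) by auto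
  moreover have "c \<notin> {a<..k}" 
  proof
    assume "c \<in> {a<..k}"
    then have "u c \<in> u ` {Suc a..k}" by auto
    then show False using c u(2) by simp
  qed
  ultimately have yu: "y \<in> u ` insert a {k<..n}" using c by (auto simp: not_less)
  have "\<not> cyc (u a) (u c) y" if "c \<in> {a<..k}" for c
  proof -
    have "u c \<in> S - {y}" unfolding u(2)[symmetric] using that by auto
    then show ?thesis using y(3) uc[of a] by auto
  qed
  then obtain w bs1 where w: "folds w bs1 (row a k n) u" "w a = y"
    using row_exists[OF ak assms(1) permutes_inj[OF up] yu] by blast
  have "folds w (bs1 @ bs2) (rows n k a) v"
    using w(1) u(1) folds_length[OF w(1)] by (auto simp: rows_step[OF ak] folds_append)
  moreover have "w ` {a..k} = S"
  proof -
    have "{a..k} = insert a {Suc a..k}" using ak by auto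
    moreover have "w ` {Suc a..k} = u ` {Suc a..k}"
      by (rule image_cong[OF refl], rule row_image(2)[OF w(1)]) auto
    ultimately show ?thesis using u(2) w(2) y(1) by auto
  qed
  ultimately show ?case by blast
qed

text \<open>The column of index $j$ is read off before the block $\Gamma^j$ is folded.\<close>

fun column_sets :: "nat \<Rightarrow> (nat \<Rightarrow> nat) \<Rightarrow> bool list \<Rightarrow> nat list \<Rightarrow> nat set list" where
  "column_sets n w bs [] = []"
| "column_sets n w bs (k # ks) = (let l = length (Gamma_k n k) in
     w ` {1..k} # column_sets n (right_mult w (selected (take l bs) (Gamma_k n k)))
       (drop l bs) ks)"

lemma folds_right_mult:
  "folds w bs G v \<Longrightarrow> right_mult w (selected bs G) = v"
  by (induction w bs G v rule: folds.induct)
    (auto split: if_splits simp del: o_apply)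

lemma folds_Gamma_k_permutes:
  assumes "folds w bs (Gamma_k n k) v" "v permutes {1..n}" "k \<le> n"
  shows "w permutes {1..n}"
  using rows_image(2)[OF assms(1)[unfolded Gamma_k_rows] assms(2)] assms(3) by auto

text \<open>Since the end point is known, the induction settles the later blocks first; their start
  \<open>u\<close> is then the end point for \<open>rows_unique\<close> in the first block. There
  \<open>u\<close> must be a permutation, so this is part of the conclusion.\<close>

lemma chain_unique:
  assumes "\<And>k. k \<in> set ks \<Longrightarrow> k \<le> n"
    and "folds w bs (concat (map (Gamma_k n) ks)) id" "folds w' bs' (concat (map (Gamma_k n) ks)) id"
    and "column_sets n w bs ks = column_sets n w' bs' ks"
  shows "w permutes {1..n} \<and> w = w' \<and> bs = bs'"
  using assms
proof (induction ks arbitrary: w bs w' bs')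
  case Nil
  then show ?case by (cases bs; cases bs') (auto simp: permutes_id simp del: id_apply)
next
  case (Cons k ks)
  let ?l = "length (Gamma_k n k)" and ?H = "concat (map (Gamma_k n) ks)"
  obtain u where u: "folds w (take ?l bs) (Gamma_k n k) u" "folds u (drop ?l bs) ?H id"
    using Cons.prems(2) by (auto simp: folds_append simp del: id_apply)
  obtain u' where u': "folds w' (take ?l bs') (Gamma_k n k) u'" "folds u' (drop ?l bs') ?H id"
    using Cons.prems(3) by (auto simp: folds_append simp del: id_apply)
  have "u permutes {1..n} \<and> u = u' \<and> drop ?l bs = drop ?l bs'"
    using Cons.prems(1,4) folds_right_mult[OF u(1)] folds_right_mult[OF u'(1)]
    by (intro Cons.IH[OF _ u(2) u'(2)]) (auto simp: Let_def)
  then have uu: "u permutes {1..n}" "u = u'" "drop ?l bs = drop ?l bs'" by auto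
  have "w ` {1..k} = w' ` {1..k}" using Cons.prems(4) by (simp add: Let_def)
  then have "w = w' \<and> take ?l bs = take ?l bs'"
    using rows_unique[of k n u 1 w "take ?l bs" w' "take ?l bs'"] u u' uu Cons.prems(1)
    by (simp add: Gamma_k_rows)
  moreover have "w permutes {1..n}"
    using folds_Gamma_k_permutes[OF u(1) uu(1)] Cons.prems(1) by auto
  ultimately show ?case using uu(3) eq_by_take_drop[of ?l bs bs'] by blast
qed

lemma chain_exists:
  assumes "\<And>k. k \<in> set ks \<Longrightarrow> k \<le> n"
    and "list_all2 (\<lambda>C k. C \<subseteq> {1..n} \<and> card C = k) Cs ks"
  shows "\<exists>w bs. w permutes {1..n} \<and> folds w bs (concat (map (Gamma_k n) ks)) id \<and>
    column_sets n w bs ks = Cs"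
  using assms
proof (induction ks arbitrary: Cs)
  case Nil
  have "folds id [] [] id" by (simp only: folds.simps)
  moreover have "Cs = []" using Nil by simp
  moreover note permutes_id[of "{1..n}"]
  ultimately show ?case unfolding list.map concat.simps column_sets.simps by blast
next
  case (Cons k ks)
  let ?l = "length (Gamma_k n k)" and ?H = "concat (map (Gamma_k n) ks)"
  obtain C Cs' where Cs: "Cs = C # Cs'" "C \<subseteq> {1..n}" "card C = k"
    "list_all2 (\<lambda>C k. C \<subseteq> {1..n} \<and> card C = k) Cs' ks"
    using Cons.prems(2) by (auto simp: list_all2_Cons2)
  obtain u bs2 where u: "u permutes {1..n}" "folds u bs2 ?H id" "column_sets n u bs2 ks = Cs'"
    using Cons.IH[OF _ Cs(4)] Cons.prems(1) by (meson list.set_intros(2))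
  obtain w bs1 where w: "folds w bs1 (Gamma_k n k) u" "w ` {1..k} = C"
    using rows_exists[of k n u 1 C] u(1) Cs Cons.prems(1) by (auto simp: Gamma_k_rows)
  have l: "length bs1 = ?l" using folds_length[OF w(1)] .
  have "folds w (bs1 @ bs2) (concat (map (Gamma_k n) (k # ks))) id"
    using w(1) u(2) l by (auto simp: folds_append simp del: id_apply)
  moreover have "column_sets n w (bs1 @ bs2) (k # ks) = Cs"
    using w u l Cs folds_right_mult[OF w(1)] by (simp add: Let_def)
  moreover have "w permutes {1..n}"
    using folds_Gamma_k_permutes[OF w(1) u(1)] Cons.prems(1) by auto
  ultimately show ?case by blast
qed

lemma column_sets_shape:
  assumes "\<And>k. k \<in> set ks \<Longrightarrow> k \<le> n" "folds w bs (concat (map (Gamma_k n) ks)) id"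
  shows "list_all2 (\<lambda>C k. C \<subseteq> {1..n} \<and> card C = k) (column_sets n w bs ks) ks"
  using assms
proof (induction ks arbitrary: w bs)
  case (Cons k ks)
  let ?l = "length (Gamma_k n k)"
  obtain u where u: "folds w (take ?l bs) (Gamma_k n k) u"
      "folds u (drop ?l bs) (concat (map (Gamma_k n) ks)) id"
    using Cons.prems(2) by (auto simp: folds_append simp del: id_apply)
  have w: "w permutes {1..n}"
    \<comment> \<open>The path is compared with itself, only to learn that its start is a
      permutation.\<close>
    using chain_unique[OF Cons.prems(1) Cons.prems(2) Cons.prems(2)] by blast
  have "k \<le> n" using Cons.prems(1) by simp
  then have "w ` {1..k} \<subseteq> {1..n}" using image_mono[of "{1..k}" "{1..n}" w] permutes_image[OF w] by simp
  moreover have "card (w ` {1..k}) = k"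
    using permutes_inj[OF w] by (simp add: card_image inj_on_subset[OF _ subset_UNIV])
  ultimately show ?case
    using Cons.IH[OF _ u(2)] Cons.prems(1) folds_right_mult[OF u(1)] by (simp add: Let_def)
qed simp

section \<open>Length change of a folding\<close>

lemma perm_length_transpose:
  assumes "inj w" "1 \<le> a" "a < b" "b \<le> n" "w a < w b"
  shows "perm_length n (w \<circ> Transposition.transpose a b) =
    perm_length n w + 1 + 2 * card {c \<in> {a<..<b}. w a < w c \<and> w c < w b}"
proof -
  let ?t = "Transposition.transpose a b"
  \<comment> \<open>Relabelling positions by \<open>?t\<close> turns the inversions of the folded word into the pairs of
    \<open>I'\<close>, which differ from the inversions \<open>I\<close> of \<open>w\<close> only in pairs meeting \<open>a\<close> or \<open>b\<close>.\<close>
  define I where "I = {(i, j). i \<in> {1..n} \<and> j \<in> {1..n} \<and> i < j \<and> w j < w i}"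
  define I' where "I' = {(i, j). i \<in> {1..n} \<and> j \<in> {1..n} \<and> ?t i < ?t j \<and> w j < w i}"
  define lo where "lo = {c \<in> {a<..<b}. w c < w a}"
  define mid where "mid = {c \<in> {a<..<b}. w a < w c \<and> w c < w b}"
  define hi where "hi = {c \<in> {a<..<b}. w b < w c}"
  have weq: "w x = w y \<longleftrightarrow> x = y" for x y using inj_eq[OF assms(1)] .
  have fin: "finite lo" "finite mid" "finite hi" by (auto simp: lo_def mid_def hi_def)
  have lomid: "lo \<union> mid = {c \<in> {a<..<b}. w c < w b}"
    using assms(5) weq[of a] by (auto simp: lo_def mid_def) (metis linorder_neqE_nat less_irrefl)
  have midhi: "mid \<union> hi = {c \<in> {a<..<b}. w a < w c}"
    using assms(5) weq[of b] by (auto simp: hi_def mid_def) (metis linorder_neqE_nat less_irrefl)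
  have finI: "finite I" by (rule finite_subset[of _ "{1..n} \<times> {1..n}"]) (auto simp: I_def)
  have tin: "?t i \<in> {1..n} \<longleftrightarrow> i \<in> {1..n}" for i using assms by (auto simp: transpose_def)
  have "{(i, j). 1 \<le> i \<and> i < j \<and> j \<le> n \<and> (w \<circ> ?t) j < (w \<circ> ?t) i} = map_prod ?t ?t ` I'"
  proof (intro equalityI subsetI)
    fix x assume "x \<in> {(i, j). 1 \<le> i \<and> i < j \<and> j \<le> n \<and> (w \<circ> ?t) j < (w \<circ> ?t) i}"
    then obtain i j where x: "x = (i, j)" "i \<in> {1..n}" "j \<in> {1..n}" "i < j" "w (?t j) < w (?t i)"
      by auto
    then have "(?t i, ?t j) \<in> I'" unfolding I'_def using tin[of i] tin[of j] by simp
    moreover have "x = map_prod ?t ?t (?t i, ?t j)" using x by simp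
    ultimately show "x \<in> map_prod ?t ?t ` I'" by blast
  next
    fix x assume "x \<in> map_prod ?t ?t ` I'"
    then obtain i j where x: "x = (?t i, ?t j)" "i \<in> {1..n}" "j \<in> {1..n}" "?t i < ?t j" "w j < w i"
      by (auto simp: I'_def)
    then show "x \<in> {(i, j). 1 \<le> i \<and> i < j \<and> j \<le> n \<and> (w \<circ> ?t) j < (w \<circ> ?t) i}"
      using tin[of i] tin[of j] by simp
  qed
  moreover have "inj_on (map_prod ?t ?t) I'"
    by (rule inj_on_subset[OF _ subset_UNIV]) (simp add: prod.inj_map)
  ultimately have lt: "perm_length n (w \<circ> ?t) = card I'"
    by (simp add: perm_length_def card_image)
  have "{(i, j). 1 \<le> i \<and> i < j \<and> j \<le> n \<and> w j < w i} = I" by (auto simp: I_def)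
  then have l: "perm_length n w = card I" by (simp add: perm_length_def)
  \<comment> \<open>\<open>X\<close> holds the pairs that stop being inversions and \<open>Y\<close>
    those that become inversions. Each position in \<open>lo\<close> or \<open>hi\<close> loses one
    pair and gains one, each in \<open>mid\<close> gains two, and \<open>(b, a)\<close> is the
    remaining gain.\<close>
  define X where "X = Pair a ` lo \<union> (\<lambda>c. (c, b)) ` hi"
  define Y where "Y = insert (b, a) ((\<lambda>c. (c, a)) ` (mid \<union> hi) \<union> Pair b ` (lo \<union> mid))"
  have XI: "X \<subseteq> I" using assms by (auto simp: X_def I_def lo_def hi_def)
  have YI: "Y \<inter> I = {}" using assms by (auto simp: Y_def I_def lo_def mid_def hi_def)
  have I': "I' = (I - X) \<union> Y"
  proof (intro set_eqI)
    fix x :: "nat \<times> nat"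
    obtain i j where x: "x = (i, j)" by (cases x)
    have X: "x \<in> X \<longleftrightarrow> i = a \<and> a < j \<and> j < b \<and> w j < w a \<or> j = b \<and> a < i \<and> i < b \<and> w b < w i"
      unfolding x X_def lo_def hi_def by auto
    have Y: "x \<in> Y \<longleftrightarrow> i = b \<and> j = a \<or> j = a \<and> a < i \<and> i < b \<and> w a < w i \<or>
        i = b \<and> a < j \<and> j < b \<and> w j < w b"
      unfolding x Y_def lomid midhi by auto
    show "x \<in> I' \<longleftrightarrow> x \<in> (I - X) \<union> Y"
      unfolding Un_iff Diff_iff X Y unfolding x I_def I'_def using assms
      by (cases "i = a"; cases "i = b"; cases "j = a"; cases "j = b") (auto simp: transpose_def)
  qed
  have cX: "card X = card lo + card hi"
    unfolding X_def using fin
    by (subst card_Un_disjoint) (auto simp: card_image inj_on_def lo_def hi_def)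
  have "card (lo \<union> mid) = card lo + card mid" "card (mid \<union> hi) = card mid + card hi"
    using fin by (auto intro!: card_Un_disjoint simp: lo_def mid_def hi_def)
  moreover have "card ((\<lambda>c. (c, a)) ` (mid \<union> hi) \<union> Pair b ` (lo \<union> mid)) =
      card (mid \<union> hi) + card (lo \<union> mid)"
    using fin by (subst card_Un_disjoint) (auto simp: card_image inj_on_def lo_def mid_def hi_def)
  moreover have "(b, a) \<notin> (\<lambda>c. (c, a)) ` (mid \<union> hi) \<union> Pair b ` (lo \<union> mid)"
    by (auto simp: lo_def mid_def hi_def)
  ultimately have cY: "card Y = 1 + card lo + 2 * card mid + card hi"
    unfolding Y_def using fin by simp
  have finXY: "finite X" "finite Y" using fin by (auto simp: X_def Y_def)
  have "card I' = card (I - X) + card Y"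
    unfolding I' using finI finXY YI by (intro card_Un_disjoint) auto
  moreover have "card (I - X) + card X = card I"
    using XI finI finXY card_Diff_subset[of X I] card_mono[of I X] by simp
  ultimately show ?thesis unfolding lt l using cX cY by (simp add: mid_def)
qed

lemma perm_length_transpose_desc:
  assumes "inj w" "1 \<le> a" "a < b" "b \<le> n" "w b < w a"
  shows "perm_length n w =
    perm_length n (w \<circ> Transposition.transpose a b) + 1 + 2 * card {c \<in> {a<..<b}. w b < w c \<and> w c < w a}"
proof -
  let ?u = "w \<circ> Transposition.transpose a b"
  have "inj ?u" using assms(1) by (intro inj_compose) auto
  moreover have "?u a < ?u b" using assms by simp
  moreover have "?u \<circ> Transposition.transpose a b = w" by (simp add: comp_assoc)
  moreover have "{c \<in> {a<..<b}. ?u a < ?u c \<and> ?u c < ?u b} = {c \<in> {a<..<b}. w b < w c \<and> w c < w a}"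
    by (auto simp: transpose_def)
  ultimately show ?thesis using perm_length_transpose[of ?u a b n] assms by simp
qed

section \<open>Negative foldings and the energy of a sequence of foldings\<close>

lemma bruhat_less_imp_perm_length_less: "bruhat_less n u v \<Longrightarrow> perm_length n u < perm_length n v"
  unfolding bruhat_less_def
proof (induction rule: tranclp_induct)
  case (base v)
  then show ?case unfolding bruhat_step_def by blast
next
  case (step v v')
  then have "perm_length n v < perm_length n v'" unfolding bruhat_step_def by blast
  then show ?case using step.IH by simp
qed

lemma bruhat_less_transpose_iff:
  assumes "inj w" "1 \<le> a" "a < b" "b \<le> n"
  shows "bruhat_less n w (w \<circ> Transposition.transpose a b) \<longleftrightarrow> w a < w b"
proof
  assume "bruhat_less n w (w \<circ> Transposition.transpose a b)"
  then have "perm_length n w < perm_length n (w \<circ> Transposition.transpose a b)"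
    by (rule bruhat_less_imp_perm_length_less)
  moreover have "w a \<noteq> w b" using assms by (simp add: inj_eq)
  ultimately show "w a < w b" using perm_length_transpose_desc[OF assms] by (cases "w b < w a") auto
next
  assume "w a < w b"
  then have "bruhat_step n w (w \<circ> Transposition.transpose a b)"
    unfolding bruhat_step_def using perm_length_transpose[OF assms] assms by force
  then show "bruhat_less n w (w \<circ> Transposition.transpose a b)"
    unfolding bruhat_less_def by blast
qed

text \<open>The contribution of one folding to the doubled energy: the length difference comes from
  telescoping the length of the start to that of the end, and the \<open>- 1\<close> from the
  cardinality of \<open>J\<close>.\<close>

definition fold_defect :: "nat \<Rightarrow> (nat \<Rightarrow> nat) \<Rightarrow> root \<Rightarrow> rat" where
  "fold_defect n w r = (let v = w \<circ> Transposition.transpose (fst r) (snd r) in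
     of_nat (perm_length n w) - of_nat (perm_length n v) - 1 +
     2 * (if bruhat_less n w v then rho_pairing r else 0))"

text \<open>If \<open>?M\<close> is the set of positions between \<open>a\<close> and
  \<open>b\<close> with values strictly between the two entries, the defect is
  \<open>2 * (b - a - 1 - card ?M)\<close> at an ascent and \<open>2 * card ?M\<close> at a descent.
  It vanishes when \<open>?M\<close> is everything, respectively empty; the cyclic arc from
  \<open>w b\<close> to \<open>w a\<close> expresses both cases at once.\<close>

lemma fold_defect_nonneg:
  assumes "inj w" "1 \<le> a" "a < b" "b \<le> n"
  shows "fold_defect n w (a, b) \<ge> 0 \<and> (fold_defect n w (a, b) = 0 \<longleftrightarrow> good_step w a b)"
proof (cases "w a < w b")
  case True
  let ?M = "{c \<in> {a<..<b}. w a < w c \<and> w c < w b}"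
  have sub: "?M \<subseteq> {a<..<b}" by auto
  have all: "card {a<..<b} = b - a - 1" by simp
  have le: "card ?M \<le> b - a - 1" using card_mono[OF _ sub] by simp
  have "card ?M = b - a - 1 \<longleftrightarrow> ?M = {a<..<b}"
  proof
    assume "card ?M = b - a - 1"
    then show "?M = {a<..<b}" using all by (intro card_subset_eq[OF _ sub]) simp_all
  next
    assume "?M = {a<..<b}"
    then show "card ?M = b - a - 1" using all by presburger
  qed
  also have "\<dots> \<longleftrightarrow> good_step w a b"
  proof -
    have "cyc (w b) (w c) (w a) \<longleftrightarrow> \<not> (w a < w c \<and> w c < w b)" if "c \<in> {a<..<b}" for c
      using True that inj_eq[OF assms(1), of c a] inj_eq[OF assms(1), of c b] by (auto simp: cyc_def)
    then show ?thesis by (auto simp: good_step_def)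
  qed
  finally have iff: "card ?M = b - a - 1 \<longleftrightarrow> good_step w a b" .
  have "fold_defect n w (a, b) = 2 * of_nat (b - a - 1 - card ?M)"
    using perm_length_transpose[OF assms True] bruhat_less_transpose_iff[OF assms] True le assms(3)
    by (simp add: fold_defect_def rho_pairing_def of_nat_diff)
  then show ?thesis using iff le by auto
next
  case False
  then have less: "w b < w a" using inj_eq[OF assms(1), of a b] assms(3) by auto
  let ?M = "{c \<in> {a<..<b}. w b < w c \<and> w c < w a}"
  have "cyc (w b) (w c) (w a) \<longleftrightarrow> (w b < w c \<and> w c < w a)" for c
    using less by (auto simp: cyc_def)
  then have "?M = {} \<longleftrightarrow> good_step w a b" by (auto simp: good_step_def)
  then have iff: "card ?M = 0 \<longleftrightarrow> good_step w a b" by simp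
  have "fold_defect n w (a, b) = 2 * of_nat (card ?M)"
    using perm_length_transpose_desc[OF assms less] bruhat_less_transpose_iff[OF assms] False
    by (simp add: fold_defect_def)
  then show ?thesis using iff by auto
qed

lemma perm_length_eq_0:
  assumes "w permutes {1..n}"
  shows "perm_length n w = 0 \<longleftrightarrow> w = id"
proof
  assume *: "perm_length n w = 0"
  have "finite {(i, j). 1 \<le> i \<and> i < j \<and> j \<le> n \<and> w j < w i}"
    by (rule finite_subset[of _ "{1..n} \<times> {1..n}"]) auto
  then have "{(i, j). 1 \<le> i \<and> i < j \<and> j \<le> n \<and> w j < w i} = {}"
    using * by (simp add: perm_length_def)
  then have le: "w i \<le> w j" if "1 \<le> i" "i < j" "j \<le> n" for i j
    using that by (auto simp: not_less[symmetric])
  have "sorted (map w [1..<Suc n])"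
    unfolding sorted_wrt_map by (rule sorted_wrt_mono_rel[OF _ sorted_wrt_upt]) (auto intro: le)
  moreover have "distinct (map w [1..<Suc n])"
    using inj_on_subset[OF permutes_inj[OF assms] subset_UNIV] by (simp add: distinct_map del: upt_Suc)
  moreover have "set (map w [1..<Suc n]) = set [1..<Suc n]"
    using permutes_image[OF assms] by (simp add: atLeastLessThanSuc_atLeastAtMost del: upt_Suc)
  ultimately have "map w [1..<Suc n] = [1..<Suc n]"
    by (intro sorted_distinct_set_unique) (simp_all only: distinct_upt sorted_upt)
  then have "map w [1..<Suc n] = map id [1..<Suc n]" by simp
  then have "w i = id i" if "i \<in> {1..n}" for i
    using that unfolding map_eq_conv by (auto simp del: upt_Suc)
  then show "w = id" using permutes_not_in[OF assms] by (metis id_apply ext)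
next
  assume "w = id"
  then have "{(i, j). 1 \<le> i \<and> i < j \<and> j \<le> n \<and> w j < w i} = {}" by auto
  then show "perm_length n w = 0" by (simp only: perm_length_def card.empty)
qed

definition twice_energy :: "nat \<Rightarrow> (nat \<Rightarrow> nat) \<Rightarrow> root list \<Rightarrow> rat" where
  "twice_energy n w T =
     of_nat (perm_length n w) + of_nat (perm_length n (right_mult w T)) - of_nat (length T) +
     2 * (\<Sum>i<length T. if bruhat_less n (right_mult w (take i T)) (right_mult w (take (Suc i) T))
            then rho_pairing (T ! i) else 0)"

lemma twice_energy_Cons:
  "twice_energy n w (r # T) =
     fold_defect n w r + twice_energy n (w \<circ> Transposition.transpose (fst r) (snd r)) T"
  unfolding twice_energy_def fold_defect_def Let_def length_Cons sum.lessThan_Suc_shift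
    take_Suc_Cons nth_Cons_Suc right_mult_Cons take_0 nth_Cons_0 right_mult_Nil
  by (simp add: algebra_simps)

text \<open>After telescoping, the doubled energy is the sum of the defects plus twice the length of
  the end point. All these terms are nonnegative, and only the identity has length 0.\<close>

lemma twice_energy_nonneg:
  assumes "w permutes {1..n}" "\<And>r. r \<in> set T \<Longrightarrow> 1 \<le> fst r \<and> fst r < snd r \<and> snd r \<le> n"
  shows "twice_energy n w T \<ge> 0 \<and>
    (twice_energy n w T = 0 \<longleftrightarrow> folds w (replicate (length T) True) T id)"
  using assms
proof (induction T arbitrary: w)
  case Nil
  then show ?case using perm_length_eq_0[of w n] by (simp add: twice_energy_def del: id_apply)
next
  case (Cons r T)
  let ?v = "w \<circ> Transposition.transpose (fst r) (snd r)"
  have r: "1 \<le> fst r" "fst r < snd r" "snd r \<le> n" using Cons.prems(2) by auto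
  have "?v permutes {1..n}" using r Cons.prems(1)
    by (intro permutes_compose[OF permutes_swap_id]) auto
  then have IH: "twice_energy n ?v T \<ge> 0 \<and>
      (twice_energy n ?v T = 0 \<longleftrightarrow> folds ?v (replicate (length T) True) T id)"
    using Cons.IH Cons.prems(2) by (meson list.set_intros(2))
  have "fold_defect n w r \<ge> 0 \<and> (fold_defect n w r = 0 \<longleftrightarrow> good_step w (fst r) (snd r))"
    using fold_defect_nonneg[OF permutes_inj[OF Cons.prems(1)] r] by simp
  then show ?case using IH unfolding twice_energy_Cons
    by (simp add: add_nonneg_eq_0_iff del: o_apply id_apply)
qed

section \<open>Folding pairs and their fillings\<close>

text \<open>Passes between the list of folded roots, on which the energy is computed, and the marked
  chain, on which paths are classified.\<close>

lemma folds_selected: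
  "length bs = length G \<Longrightarrow>
   folds w (replicate (length (selected bs G)) True) (selected bs G) v \<longleftrightarrow> folds w bs G v"
  by (induction bs G arbitrary: w rule: list_induct2) (auto simp del: o_apply)

lemma selected_map: "selected (map P xs) (map f xs) = map f (filter P xs)"
  by (induction xs) auto

text \<open>One statement serves both all of \<open>J\<close>, with \<open>L = 0\<close>, and its
  part in a single block.\<close>

lemma map_sorted_list_of_set_slice:
  "map f (sorted_list_of_set (J \<inter> {L<..L + l})) =
     selected (map (\<lambda>p. p \<in> J) [Suc L..<Suc (L + l)]) (map f [Suc L..<Suc (L + l)])"
proof -
  have "sorted_list_of_set (J \<inter> {L<..L + l}) = filter (\<lambda>p. p \<in> J) [Suc L..<Suc (L + l)]"
    by (rule sorted_distinct_set_unique) (auto simp: sorted_wrt_filter simp del: upt_Suc)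
  then show ?thesis by (simp only: selected_map)
qed

section \<open>Cutting the chain into blocks\<close>

lemma Gamma_above_Suc:
  "Suc j \<le> \<mu> 1 \<Longrightarrow> Gamma_above n \<mu> j = Gamma_above n \<mu> (Suc j) @ Gamma_col n \<mu> (Suc j)"
  by (simp add: Gamma_above_def upt_conv_Cons[of "Suc j"] del: upt_Suc)

lemma Gamma_chain_split:
  "j \<le> \<mu> 1 \<Longrightarrow> Gamma_chain n \<mu> = Gamma_above n \<mu> j @ concat (map (Gamma_col n \<mu>) (rev [1..<Suc j]))"
proof (induction j)
  case 0
  then show ?case by (simp add: Gamma_chain_def)
next
  case (Suc j)
  then show ?case using Gamma_above_Suc[of j \<mu> n] by simp
qed

lemma chain_root_slice:
  assumes "Gamma_chain n \<mu> = A @ B @ C"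
  shows "map (chain_root n \<mu>) [Suc (length A)..<Suc (length A + length B)] = B"
  by (rule nth_equalityI) (auto simp: chain_root_def assms nth_append simp del: upt_Suc)

lemma Gamma_chain_roots:
  assumes "r \<in> set (Gamma_chain n \<mu>)"
  shows "1 \<le> fst r \<and> fst r < snd r \<and> snd r \<le> n"
  using assms by (auto simp: Gamma_chain_def Gamma_above_def Gamma_col_def Gamma_k_def simp del: upt_Suc)

definition mask :: "nat \<Rightarrow> (nat \<Rightarrow> nat) \<Rightarrow> nat set \<Rightarrow> bool list" where
  "mask n \<mu> J = map (\<lambda>p. p \<in> J) [1..<Suc (length (Gamma_chain n \<mu>))]"

lemma folded_roots_eq_selected:
  assumes "J \<subseteq> {1..length (Gamma_chain n \<mu>)}"
  shows "map (chain_root n \<mu>) (sorted_list_of_set J) = selected (mask n \<mu> J) (Gamma_chain n \<mu>)"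
proof -
  let ?m = "length (Gamma_chain n \<mu>)"
  have "J \<inter> {0<..0 + ?m} = J" using assms by auto
  then show ?thesis
    using map_sorted_list_of_set_slice[of "chain_root n \<mu>" J 0 ?m] chain_root_slice[of n \<mu> "[]" "Gamma_chain n \<mu>" "[]"]
    by (simp add: mask_def del: upt_Suc)
qed

text \<open>The left side runs over chain positions, the right side over indices of a list. The
  sorted list of \<open>J\<close> has no repetitions, so indexing into it matches the two; foldings
  are numbered from 1, hence the shifts by one.\<close>

lemma sum_negative_foldings:
  fixes n \<mu> w J
  defines "T \<equiv> map (chain_root n \<mu>) (sorted_list_of_set J)"
  assumes "finite J"
  shows "(\<Sum>p \<in> negative_foldings n \<mu> w J. rho_pairing (chain_root n \<mu> p)) =
    (\<Sum>i<length T. if bruhat_less n (right_mult w (take i T)) (right_mult w (take (Suc i) T))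
       then rho_pairing (T ! i) else 0)"
proof -
  let ?s = "sorted_list_of_set J"
  define P where "P i = bruhat_less n (right_mult w (take i T)) (right_mult w (take (Suc i) T))" for i
  have len: "length T = card J" "length ?s = card J" by (simp_all add: T_def)
  have "negative_foldings n \<mu> w J = (!) ?s ` {i \<in> {..<card J}. P i}"
  proof (intro equalityI subsetI)
    fix x assume "x \<in> negative_foldings n \<mu> w J"
    then obtain i where "i \<in> {1..card J}" "x = ?s ! (i - 1)" "P (i - 1)"
      by (auto simp: negative_foldings_def P_def T_def partial_fold_def take_map)
    then show "x \<in> (!) ?s ` {i \<in> {..<card J}. P i}" by (intro image_eqI[of _ _ "i - 1"]) auto
  next
    fix x assume "x \<in> (!) ?s ` {i \<in> {..<card J}. P i}"
    then obtain i where "i < card J" "x = ?s ! i" "P i" by auto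
    then show "x \<in> negative_foldings n \<mu> w J"
      unfolding negative_foldings_def
      by (intro CollectI exI[of _ "Suc i"]) (auto simp: P_def T_def partial_fold_def take_map)
  qed
  moreover have "inj_on ((!) ?s) {i \<in> {..<card J}. P i}"
    by (rule inj_onI) (auto simp: nth_eq_iff_index_eq len)
  ultimately have "(\<Sum>p \<in> negative_foldings n \<mu> w J. rho_pairing (chain_root n \<mu> p)) =
      (\<Sum>i\<in>{i \<in> {..<card J}. P i}. rho_pairing (chain_root n \<mu> (?s ! i)))"
    by (simp add: sum.reindex)
  also have "\<dots> = (\<Sum>i\<in>{i \<in> {..<card J}. P i}. rho_pairing (T ! i))"
    by (rule sum.cong) (auto simp: T_def len)
  also have "\<dots> = (\<Sum>i<card J. if P i then rho_pairing (T ! i) else 0)"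
    by (rule sum.inter_filter) simp
  finally show ?thesis by (simp add: P_def len)
qed

text \<open>The defining expression is half of \<open>twice_energy\<close>; its vanishing is a
  condition on the selected roots, which \<open>folds_selected\<close> carries over to the marked
  chain.\<close>

lemma F_bar_iff_folds:
  "(w, J) \<in> F_bar n \<mu> \<longleftrightarrow>
     w permutes {1..n} \<and> J \<subseteq> {1..length (Gamma_chain n \<mu>)} \<and>
     folds w (mask n \<mu> J) (Gamma_chain n \<mu>) id"
proof (cases "w permutes {1..n} \<and> J \<subseteq> {1..length (Gamma_chain n \<mu>)}")
  case True
  then have w: "w permutes {1..n}" and J: "J \<subseteq> {1..length (Gamma_chain n \<mu>)}" by auto
  define T where "T = map (chain_root n \<mu>) (sorted_list_of_set J)"
  have fin: "finite J" using J finite_subset by blast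
  have T: "T = selected (mask n \<mu> J) (Gamma_chain n \<mu>)"
    unfolding T_def by (rule folded_roots_eq_selected[OF J])
  have len: "length T = card J" by (simp add: T_def)
  have e: "end_fold n \<mu> w J = right_mult w T"
    by (simp add: end_fold_def partial_fold_def T_def)
  have "1/2 * (of_nat (perm_length n w) + of_nat (perm_length n (end_fold n \<mu> w J)) - of_nat (card J))
       + (\<Sum>p \<in> negative_foldings n \<mu> w J. rho_pairing (chain_root n \<mu> p)) = twice_energy n w T / 2"
    unfolding e sum_negative_foldings[OF fin] T_def[symmetric] twice_energy_def len
    by (simp add: field_simps)
  then have "(w, J) \<in> F_bar n \<mu> \<longleftrightarrow> twice_energy n w T = 0"
    using w J unfolding F_bar_def folding_pairs_def mem_Collect_eq prod.case by (simp only: divide_eq_0_iff) simp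
  also have "\<dots> \<longleftrightarrow> folds w (replicate (length T) True) T id"
  proof -
    have "set T \<subseteq> set (Gamma_chain n \<mu>)" unfolding T by (auto dest: set_zip_rightD)
    then show ?thesis using twice_energy_nonneg[OF w, of T] Gamma_chain_roots by blast
  qed
  also have "\<dots> \<longleftrightarrow> folds w (mask n \<mu> J) (Gamma_chain n \<mu>) id"
    unfolding T by (rule folds_selected) (simp add: mask_def del: upt_Suc)
  finally show ?thesis using True by blast
next
  case False
  then show ?thesis by (auto simp: F_bar_def folding_pairs_def)
qed

lemma column_sets_eq_pi_perm_images:
  fixes n \<mu> w J
  defines "ks \<equiv> map (conj_part n \<mu>) (rev [1..<Suc (\<mu> 1)])"
  shows "column_sets n w (mask n \<mu> J) ks =
    map (\<lambda>j. pi_perm n \<mu> w J j ` {1..conj_part n \<mu> j}) (rev [1..<Suc (\<mu> 1)])"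
proof -
  let ?m = "length (Gamma_chain n \<mu>)"
  \<comment> \<open>Generalised to the blocks \<open>j\<close>, ..., 1 and an arbitrary start, with
    the marks of the blocks above \<open>j\<close> cut off. At \<open>j = \<mu> 1\<close> nothing is
    cut off.\<close>
  have "column_sets n w (map (\<lambda>p. p \<in> J) [Suc (length (Gamma_above n \<mu> j))..<Suc ?m])
      (map (conj_part n \<mu>) (rev [1..<Suc j])) =
    map (\<lambda>i. right_mult w (concat (map (T_part n \<mu> J) (rev [Suc i..<Suc j]))) ` {1..conj_part n \<mu> i})
      (rev [1..<Suc j])" if "j \<le> \<mu> 1" for j
    using that
  proof (induction j arbitrary: w)
    case 0
    then show ?case by simp
  next
    case (Suc j)
    let ?L = "length (Gamma_above n \<mu> (Suc j))" and ?G = "Gamma_col n \<mu> (Suc j)"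
    let ?l = "length ?G"
    have above: "length (Gamma_above n \<mu> j) = ?L + ?l"
      using Gamma_above_Suc[of j \<mu> n] Suc.prems by simp
    have chain: "Gamma_chain n \<mu> =
        Gamma_above n \<mu> (Suc j) @ ?G @ concat (map (Gamma_col n \<mu>) (rev [1..<Suc j]))"
      using Gamma_chain_split[of "Suc j" \<mu> n] Suc.prems by simp
    then have "?L + ?l \<le> ?m" by simp
    then have split: "[Suc ?L..<Suc ?m] = [Suc ?L..<Suc (?L + ?l)] @ [Suc (?L + ?l)..<Suc ?m]"
      using upt_add_eq_append[of "Suc ?L" "Suc (?L + ?l)" "?m - (?L + ?l)"] by (simp del: upt_Suc)
    have T: "selected (map (\<lambda>p. p \<in> J) [Suc ?L..<Suc (?L + ?l)]) ?G = T_part n \<mu> J (Suc j)"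
      using map_sorted_list_of_set_slice[of "chain_root n \<mu>" J ?L ?l] chain_root_slice[OF chain]
      by (simp add: T_part_def block_positions_def del: upt_Suc)
    have rm: "right_mult (right_mult w T) T' = right_mult w (T @ T')" for w T T'
      by (simp add: right_mult_def)
    have rv: "rev [1..<Suc (Suc j)] = Suc j # rev [1..<Suc j]" by simp
    let ?u = "right_mult w (T_part n \<mu> J (Suc j))"
    have "column_sets n w (map (\<lambda>p. p \<in> J) [Suc ?L..<Suc ?m]) (map (conj_part n \<mu>) (rev [1..<Suc (Suc j)])) =
      w ` {1..conj_part n \<mu> (Suc j)} #
      column_sets n ?u (map (\<lambda>p. p \<in> J) [Suc (?L + ?l)..<Suc ?m]) (map (conj_part n \<mu>) (rev [1..<Suc j]))"
      unfolding split rv using T by (simp add: Let_def Gamma_col_def[symmetric] del: upt_Suc)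
    also have "\<dots> = w ` {1..conj_part n \<mu> (Suc j)} #
      map (\<lambda>i. right_mult ?u (concat (map (T_part n \<mu> J) (rev [Suc i..<Suc j]))) ` {1..conj_part n \<mu> i})
      (rev [1..<Suc j])"
      using Suc.IH[of ?u] Suc.prems above by simp
    also have "\<dots> = map (\<lambda>i. right_mult w (concat (map (T_part n \<mu> J) (rev [Suc i..<Suc (Suc j)]))) ` {1..conj_part n \<mu> i})
      (rev [1..<Suc (Suc j)])"
      unfolding rv rm by (auto simp: upt_Suc[of _ "Suc j"] simp del: upt_Suc)
    finally show ?case .
  qed
  from this[of "\<mu> 1"] show ?thesis
    by (simp add: ks_def mask_def pi_perm_def Gamma_above_def del: upt_Suc)
qed

lemma inj_right_mult: "inj w \<Longrightarrow> inj (right_mult w T)"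
proof (induction T arbitrary: w)
  case (Cons r T)
  have "inj (w \<circ> Transposition.transpose (fst r) (snd r))"
    using Cons.prems by (intro inj_compose) auto
  then show ?case using Cons.IH by simp
qed simp

text \<open>The entries of a column are distinct, so sorting it retains exactly its set of entries.
  This reduces the bijection to sequences of column sets.\<close>

lemma ord_filling_map_eq:
  assumes "w permutes {1..n}"
  shows "(ord_cols \<circ> filling_map n \<mu>) (w, J) =
    map sorted_list_of_set
      (column_sets n w (mask n \<mu> J) (map (conj_part n \<mu>) (rev [1..<Suc (\<mu> 1)])))"
proof -
  have "sort (map (pi_perm n \<mu> w J j) [1..<Suc k]) = sorted_list_of_set (pi_perm n \<mu> w J j ` {1..k})"
    for j k
  proof -
    have "inj (pi_perm n \<mu> w J j)"
      unfolding pi_perm_def by (rule inj_right_mult[OF permutes_inj[OF assms]])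
    then have "distinct (map (pi_perm n \<mu> w J j) [1..<Suc k])"
      by (simp add: distinct_map inj_on_subset[OF _ subset_UNIV] del: upt_Suc)
    then have "sort (map (pi_perm n \<mu> w J j) [1..<Suc k]) =
        sorted_list_of_set (set (map (pi_perm n \<mu> w J j) [1..<Suc k]))"
      by (simp only: sorted_list_of_set_sort_remdups remdups_id_iff_distinct[THEN iffD2])
    then show ?thesis by (simp add: atLeastLessThanSuc_atLeastAtMost del: upt_Suc)
  qed
  then show ?thesis
    unfolding column_sets_eq_pi_perm_images by (simp add: ord_cols_def filling_map_def del: upt_Suc)
qed

theorem theorem4p1:
  fixes n :: nat and \<mu> :: "nat \<Rightarrow> nat"
  assumes "n \<ge> 2"
    and "antimono_on {1..n} \<mu>"
    and "\<mu> n = 0"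
  shows "bij_betw (ord_cols \<circ> filling_map n \<mu>) (F_bar n \<mu>) (B_fillings n \<mu>)"
proof -
  define ks where "ks = map (conj_part n \<mu>) (rev [1..<Suc (\<mu> 1)])"
  let ?G = "Gamma_chain n \<mu>" and ?f = "ord_cols \<circ> filling_map n \<mu>"
  let ?shape = "\<lambda>Cs. list_all2 (\<lambda>C k. C \<subseteq> {1..n} \<and> card C = k) Cs ks"
  have ks: "k \<le> n" if "k \<in> set ks" for k
  proof -
    have "conj_part n \<mu> j \<le> n" for j
    proof -
      have "card {i \<in> {1..n}. j \<le> \<mu> i} \<le> card {1..n}" by (rule card_mono) auto
      then show ?thesis by (simp add: conj_part_def)
    qed
    then show ?thesis using that by (auto simp: ks_def)
  qed
  have G: "?G = concat (map (Gamma_k n) ks)"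
    by (simp add: Gamma_chain_def Gamma_above_def Gamma_col_def[abs_def] ks_def comp_def del: upt_Suc)
  have f: "?f (w, J) = map sorted_list_of_set (column_sets n w (mask n \<mu> J) ks)"
      "?shape (column_sets n w (mask n \<mu> J) ks)"
      "folds w (mask n \<mu> J) (concat (map (Gamma_k n) ks)) id"
      "J \<subseteq> {1..length ?G}" if "(w, J) \<in> F_bar n \<mu>" for w J
    using that[unfolded F_bar_iff_folds] column_sets_shape[OF ks] ord_filling_map_eq
    unfolding G ks_def by blast+
  \<comment> \<open>Finite sets are recovered from their sorted lists, so equal sorted fillings have
    equal column sets.\<close>
  have set_inverse: "map set (map sorted_list_of_set Cs) = Cs" if "?shape Cs" for Cs :: "nat set list"
  proof -
    have "finite C" if "C \<in> set Cs" for C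
    proof (rule finite_subset)
      show "C \<subseteq> {1..n}"
        using \<open>?shape Cs\<close> that by (auto simp: list_all2_conv_all_nth in_set_conv_nth)
    qed simp
    then show ?thesis by (simp add: map_idI)
  qed
  show ?thesis
  proof (rule bij_betw_imageI)
    show "inj_on ?f (F_bar n \<mu>)"
    proof (rule inj_onI, clarify)
      fix w J w' J'
      assume *: "(w, J) \<in> F_bar n \<mu>" "(w', J') \<in> F_bar n \<mu>" "?f (w, J) = ?f (w', J')"
      have "column_sets n w (mask n \<mu> J) ks = map set (?f (w, J))"
        unfolding f(1)[OF *(1)] set_inverse[OF f(2)[OF *(1)]] ..
      also have "\<dots> = column_sets n w' (mask n \<mu> J') ks"
        unfolding *(3) f(1)[OF *(2)] set_inverse[OF f(2)[OF *(2)]] ..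
      finally have "column_sets n w (mask n \<mu> J) ks = column_sets n w' (mask n \<mu> J') ks" .
      then have eq: "w = w'" "mask n \<mu> J = mask n \<mu> J'"
        using chain_unique[OF ks f(3)[OF *(1)] f(3)[OF *(2)]] by auto
      have "p \<in> J \<longleftrightarrow> p \<in> J'" if "p \<in> {1..length ?G}" for p
        using eq(2) that unfolding mask_def map_eq_conv by (simp del: upt_Suc)
      then have "J = J'" using f(4)[OF *(1)] f(4)[OF *(2)] by blast
      then show "w = w' \<and> J = J'" using eq by simp
    qed
    show "?f ` F_bar n \<mu> = B_fillings n \<mu>"
    proof (intro equalityI subsetI)
      fix F assume "F \<in> ?f ` F_bar n \<mu>"
      then obtain w J where *: "(w, J) \<in> F_bar n \<mu>" "F = ?f (w, J)" by auto
      define Cs where "Cs = column_sets n w (mask n \<mu> J) ks"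
      have Cs: "?shape Cs" and F: "F = map sorted_list_of_set Cs" using f(1,2) * by (auto simp: Cs_def)
      have "map length F = ks" using Cs unfolding F
        by (auto simp: list_all2_conv_all_nth intro!: nth_equalityI)
      moreover have "set C \<subseteq> {1..n} \<and> sorted_wrt (<) C" if C: "C \<in> set F" for C
      proof -
        obtain A where A: "A \<in> set Cs" "C = sorted_list_of_set A" using C F by auto
        then have "A \<subseteq> {1..n}" using Cs by (auto simp: list_all2_conv_all_nth in_set_conv_nth)
        moreover from this have "finite A" by (rule finite_subset) simp
        ultimately show ?thesis using A(2) by simp
      qed
      ultimately show "F \<in> B_fillings n \<mu>" by (simp add: B_fillings_def ks_def)
    next
      fix F assume "F \<in> B_fillings n \<mu>"
      then have F: "map length F = ks" "\<And>C. C \<in> set F \<Longrightarrow> set C \<subseteq> {1..n} \<and> sorted_wrt (<) C"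
        by (auto simp: B_fillings_def ks_def)
      \<comment> \<open>Strict increase makes the size of the set equal to the height of the column,
        as \<open>chain_exists\<close> demands.\<close>
      have "?shape (map set F)"
        unfolding F(1)[symmetric] list_all2_map1 list_all2_map2
        by (rule list.rel_refl_strong) (use F(2) in \<open>auto simp: strict_sorted_iff distinct_card\<close>)
      then obtain w bs where w: "w permutes {1..n}" "folds w bs ?G id" "column_sets n w bs ks = map set F"
        using chain_exists[OF ks] unfolding G by blast
      \<comment> \<open>Positions in the chain count from 1, entries of \<open>bs\<close> from
        0.\<close>
      define J where "J = {p \<in> {1..length ?G}. bs ! (p - 1)}"
      have mask: "mask n \<mu> J = bs"
        using folds_length[OF w(2)]
        by (auto simp: mask_def J_def intro!: nth_equalityI simp del: upt_Suc)
      have "J \<subseteq> {1..length ?G}" by (auto simp: J_def)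
      then have J: "(w, J) \<in> F_bar n \<mu>" using w mask by (simp add: F_bar_iff_folds del: id_apply)
      have fJ: "?f (w, J) = map sorted_list_of_set (map set F)"
        unfolding f(1)[OF J] mask w(3) ..
      have "map sorted_list_of_set (map set F) = F"
        using F(2) by (auto simp: map_idI strict_sorted_iff sorted_list_of_set.idem_if_sorted_distinct)
      then show "F \<in> ?f ` F_bar n \<mu>" using J fJ by (metis image_eqI)
    qed
  qed
qed

end
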